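(* Let $\Sigma,\Sigma'$ be alphabets and let $\mathtt{Compress}:\Sigma^*\to(\Sigma')^*$ be a compression function (with $\{0,1\}\subseteq\Sigma'$). For $\epsilon,\delta>0$ define $A_{\epsilon,\delta}(w):=\mathtt{DPCompress}(w,\epsilon,\delta)$, where $\mathtt{DPCompress}$ is the randomized algorithm described in the context. Then for any $\epsilon,\delta>0$, the algorithm $A_{\epsilon,\delta}$ is an $(\epsilon,\delta)$-differentially private compression scheme: for every $n\ge 1$, every pair $w,w'\in\Sigma^n$ differing in exactly one position, and every $S\subseteq\mathbb{N}$, $$\Pr[|A_{\epsilon,\delta}(w)|\in S]\le e^{\epsilon}\Pr[|A_{\epsilon,\delta}(w')|\in S]+\delta .$$
   Context: Two strings $w,w'\in\Sigma^n$ are neighbors ($w\sim w'$) if they differ in exactly one position. The global sensitivity of $\mathtt{Compress}$ on strings of length $n$ is $\mathrm{GS}_{\mathtt{Compress}}=\max_{w\in\Sigma^n}\max_{w'\in\Sigma^n:\,w\sim w'}\big||\mathtt{Compress}(w)|-|\mathtt{Compress}(w')|\big|$, where $|\cdot|$ denotes string length. $\mathrm{Lap}(b)$ denotes the Laplace distribution with mean $0$ and scale $b$. On input $(w,\epsilon,\delta)$ with $|w|=n$, $\mathtt{DPCompress}$ samples $Z\sim\mathrm{Lap}(\mathrm{GS}_{\mathtt{Compress}}/\epsilon)$, sets $k=\frac{\mathrm{GS}_{\mathtt{Compress}}}{\epsilon}\ln\!\big(\frac{1}{2\delta}\big)+\mathrm{GS}_{\mathtt{Compress}}+1$ and $p=\max\{1,\lceil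 Z+k\rceil\}$, and outputs $\mathtt{Compress}(w)\circ 0\circ 1^{p-1}$ (concatenation; $1^{p-1}$ is the symbol $1$ repeated $p-1$ times). *)

theory Defs
  imports "HOL-Probability.Probability"
begin

text \<open>
  Alphabets are finite types. The symbols 0 and 1 of the output alphabet are the constants of the
  class \<^class>\<open>zero_neq_one\<close>, which makes them two distinct elements and nothing more.
\<close>

definition neighbors :: "'a list \<Rightarrow> 'a list \<Rightarrow> bool" where
  "neighbors w w' \<longleftrightarrow>
     length w = length w' \<and> card {i. i < length w \<and> w ! i \<noteq> w' ! i} = 1"

text \<open>
  The differences are nonnegative, so inserting 0 matters only if no two strings of length
  \<open>n\<close> are neighbors (\<open>n = 0\<close> or a one-letter alphabet), where it fixes the empty
  maximum to be 0.
\<close>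

definition global_sensitivity :: "('a::finite list \<Rightarrow> 'b list) \<Rightarrow> nat \<Rightarrow> real" where
  "global_sensitivity C n =
     Max (insert 0 {\<bar>real (length (C w)) - real (length (C w'))\<bar> | w w'.
                      length w = n \<and> length w' = n \<and> neighbors w w'})"

text \<open>
  A global sensitivity of 0 leads to scale 0; that case is the limit of the
  distribution as the scale tends to 0, i.e. the point mass at the mean.
\<close>

definition laplace :: "real \<Rightarrow> real measure" where
  "laplace b =
     (if b = 0 then return borel 0
      else density lborel (\<lambda>x. ennreal (exp (- \<bar>x\<bar> / b) / (2 * b))))"

definition pad_shift :: "('a::finite list \<Rightarrow> 'b list) \<Rightarrow> nat \<Rightarrow> real \<Rightarrow> real \<Rightarrow> real" where
  "pad_shift C n \<epsilon> \<delta> =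
     global_sensitivity C n / \<epsilon> * ln (1 / (2 * \<delta>)) + global_sensitivity C n + 1"

definition pad_length ::
    "('a::finite list \<Rightarrow> 'b list) \<Rightarrow> nat \<Rightarrow> real \<Rightarrow> real \<Rightarrow> real \<Rightarrow> nat" where
  "pad_length C n \<epsilon> \<delta> z = nat (max 1 \<lceil>z + pad_shift C n \<epsilon> \<delta>\<rceil>)"

definition DPCompress ::
    "('a::finite list \<Rightarrow> 'b::{finite, zero_neq_one} list) \<Rightarrow> 'a list \<Rightarrow> real \<Rightarrow> real
      \<Rightarrow> 'b list measure" where
  "DPCompress C w \<epsilon> \<delta> =
     distr (laplace (global_sensitivity C (length w) / \<epsilon>)) (count_space UNIV)
       (\<lambda>z. C w @ [0] @ replicate (pad_length C (length w) \<epsilon> \<delta> z - 1) 1)"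

definition dp_compression_scheme ::
    "real \<Rightarrow> real \<Rightarrow> ('a list \<Rightarrow> 'b list measure) \<Rightarrow> bool" where
  "dp_compression_scheme \<epsilon> \<delta> A \<longleftrightarrow>
     (\<forall>n\<ge>1. \<forall>w w'. length w = n \<and> length w' = n \<and> neighbors w w' \<longrightarrow>
        (\<forall>S::nat set. \<P>(y in A w. length y \<in> S)
                        \<le> exp \<epsilon> * \<P>(y in A w'. length y \<in> S) + \<delta>))"


lemma sets_laplace [measurable_cong, simp]: "sets (laplace b) = sets borel"
  by (simp add: laplace_def)

lemma space_laplace [simp]: "space (laplace b) = UNIV"
  by (simp add: laplace_def)

lemma prob_space_laplace:
  assumes "b \<ge> 0"
  shows "prob_space (laplace b)"
proof (cases "b = 0")
  case True
  then show ?thesis by (simp add: laplace_def prob_space_return)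
next
  case False
  with assms have b: "b > 0" by simp
  let ?e = "exponential_density (1 / b)"
  interpret E: prob_space "density lborel ?e"
    using b by (intro prob_space_exponential_density) simp
  have e: "(\<integral>\<^sup>+x. ennreal (?e x) \<partial>lborel) = 1"
    using E.emeasure_space_1 by (simp add: emeasure_density)
  have e': "(\<integral>\<^sup>+x. ennreal (?e (- x)) \<partial>lborel) = 1"
    using nn_integral_real_affine[of "\<lambda>x. ennreal (?e x)" "-1" 0] e by simp
  have "(\<integral>\<^sup>+x. ennreal (exp (- \<bar>x\<bar> / b) / (2 * b)) \<partial>lborel) =
        (\<integral>\<^sup>+x. ennreal (1/2) * (ennreal (?e x) + ennreal (?e (- x))) \<partial>lborel)"
  proof (intro nn_integral_cong_AE)
    show "AE x in lborel. ennreal (exp (- \<bar>x\<bar> / b) / (2 * b)) =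
            ennreal (1/2) * (ennreal (?e x) + ennreal (?e (- x)))"
      using AE_lborel_singleton[of "0::real"]
    proof eventually_elim
      case (elim x)
      have "?e x \<ge> 0" "?e (- x) \<ge> 0" using b by (auto simp: exponential_density_def)
      moreover have "exp (- \<bar>x\<bar> / b) / (2 * b) = 1/2 * (?e x + ?e (- x))"
        using elim b by (auto simp: exponential_density_def)
      ultimately show ?case by (simp only: ennreal_plus[symmetric] ennreal_mult[symmetric])
    qed
  qed
  also have "\<dots> = ennreal (1/2) * ennreal 2"
    by (simp add: nn_integral_cmult nn_integral_add e e' one_add_one)
  also have "\<dots> = 1"
    by (subst ennreal_mult[symmetric]) simp_all
  finally show ?thesis
    using b by (intro prob_spaceI) (simp add: laplace_def emeasure_density)
qed

lemma global_sensitivity_nonneg: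
  fixes C :: "'a::finite list \<Rightarrow> 'b list"
  shows "global_sensitivity C n \<ge> 0"
proof -
  let ?L = "{w::'a list. length w = n}"
  let ?D = "{\<bar>real (length (C w)) - real (length (C w'))\<bar> | w w'.
               length w = n \<and> length w' = n \<and> neighbors w w'}"
  have "finite ?L" using finite_lists_length_eq[of "UNIV::'a set" n] by simp
  then have "finite ((\<lambda>(w, w'). \<bar>real (length (C w)) - real (length (C w'))\<bar>) ` (?L \<times> ?L))"
    by (intro finite_imageI finite_cartesian_product)
  moreover have "?D \<subseteq> (\<lambda>(w, w'). \<bar>real (length (C w)) - real (length (C w'))\<bar>) ` (?L \<times> ?L)"
    by auto
  ultimately have "finite ?D" by (rule rev_finite_subset)
  then show ?thesis unfolding global_sensitivity_def by (intro Max_ge) auto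
qed

lemma prob_space_DPCompress:
  assumes "\<epsilon> > 0"
  shows "prob_space (DPCompress C w \<epsilon> \<delta>)"
proof -
  interpret prob_space "laplace (global_sensitivity C (length w) / \<epsilon>)"
    using assms by (intro prob_space_laplace divide_nonneg_pos global_sensitivity_nonneg)
  have "(\<lambda>z. C w @ [0] @ replicate (pad_length C (length w) \<epsilon> \<delta> z - 1) 1)
          \<in> measurable (laplace (global_sensitivity C (length w) / \<epsilon>)) (count_space UNIV)"
    unfolding pad_length_def by measurable
  then show ?thesis unfolding DPCompress_def by (rule prob_space_distr)
qed

end

theory Submission
  imports Defs
begin

text \<open>
  The output length on \<open>w\<close> is \<open>\<lceil>Z + k + \<bar>Compress w\<bar>\<rceil>\<close> truncated from below at
  \<open>\<bar>Compress w\<bar> + 1\<close>. Truncation plays no role for either input where this value exceeds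
  \<open>m = max \<bar>Compress w\<bar> \<bar>Compress w'\<bar>\<close>, so there the two length distributions differ only by a
  translation of the Laplace noise by at most the global sensitivity, which costs a factor
  \<open>exp \<epsilon>\<close>. The shift \<open>k\<close> is chosen such that the value is at most \<open>m\<close> with probability at
  most \<open>\<delta>\<close>; the tail bound \<open>P(Z \<le> a) \<le> exp (a / b) / 2\<close> holds for \<open>a > 0\<close> as well, so
  \<open>\<delta> > 1/2\<close> is no exception.
\<close>

lemma emeasure_laplace:
  assumes "b > 0" "A \<in> sets borel"
  shows "emeasure (laplace b) A =
    (\<integral>\<^sup>+x. ennreal (exp (- \<bar>x\<bar> / b) / (2 * b)) * indicator A x \<partial>lborel)"
  using assms by (simp add: laplace_def emeasure_density)

text \<open>Translation by \<open>c\<close> turns the density \<open>?f x\<close> into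
  \<open>?f (x - c)\<close>. The triangle inequality
  \<open>\<bar>x\<bar> \<le> \<bar>x - c\<bar> + \<bar>c\<bar>\<close> bounds the ratio of the two
  pointwise by \<open>exp (\<bar>c\<bar> / b)\<close>, and integrating over \<open>A\<close> keeps
  the factor.\<close>

lemma laplace_shift:
  assumes b: "b > 0" and A [measurable]: "A \<in> sets borel"
  shows "measure (laplace b) {z. z + c \<in> A} \<le> exp (\<bar>c\<bar> / b) * measure (laplace b) A"
proof -
  interpret prob_space "laplace b" using b by (intro prob_space_laplace) simp
  let ?f = "\<lambda>x. exp (- \<bar>x\<bar> / b) / (2 * b)"
  have "emeasure (laplace b) {z. z + c \<in> A} =
      (\<integral>\<^sup>+x. ennreal (?f x) * indicator {z. z + c \<in> A} x \<partial>lborel)"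
    using b by (intro emeasure_laplace) measurable
  also have "\<dots> = (\<integral>\<^sup>+x. ennreal (?f (x - c)) * indicator A x \<partial>lborel)"
    by (subst nn_integral_real_affine[of _ 1 "- c"])
       (auto simp: indicator_def intro!: nn_integral_cong)
  also have "\<dots> \<le> (\<integral>\<^sup>+x. ennreal (exp (\<bar>c\<bar> / b)) * (ennreal (?f x) * indicator A x) \<partial>lborel)"
  proof (intro nn_integral_mono)
    fix x :: real
    have "- \<bar>x - c\<bar> / b \<le> \<bar>c\<bar> / b + - \<bar>x\<bar> / b"
      using b by (simp add: field_simps)
    then have "?f (x - c) \<le> exp (\<bar>c\<bar> / b) * ?f x"
      using b by (simp add: exp_add[symmetric] divide_right_mono)
    then show "ennreal (?f (x - c)) * indicator A x
        \<le> ennreal (exp (\<bar>c\<bar> / b)) * (ennreal (?f x) * indicator A x)"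
      using b by (auto simp: indicator_def ennreal_mult[symmetric])
  qed
  also have "\<dots> = ennreal (exp (\<bar>c\<bar> / b)) * emeasure (laplace b) A"
    using b by (simp add: nn_integral_cmult emeasure_laplace)
  finally show ?thesis
    by (simp add: emeasure_eq_measure ennreal_mult[symmetric])
qed

text \<open>From \<open>- \<bar>x\<bar> \<le> x\<close> the density is at most
  \<open>exp (x / b) / (2 * b)\<close>, whose integral up to \<open>a\<close> is exactly the bound,
  whatever the sign of \<open>a\<close>.\<close>

lemma laplace_lower_tail:
  assumes b: "b > 0"
  shows "measure (laplace b) {..a} \<le> exp (a / b) / 2"
proof -
  interpret prob_space "laplace b" using b by (intro prob_space_laplace) simp
  have "emeasure (laplace b) {..a} =
      (\<integral>\<^sup>+x. ennreal (exp (- \<bar>x\<bar> / b) / (2 * b)) * indicator {..a} x \<partial>lborel)"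
    using b by (intro emeasure_laplace) auto
  also have "\<dots> \<le> (\<integral>\<^sup>+x. ennreal (exp (x / b) / (2 * b)) * indicator {..a} x \<partial>lborel)"
    using b by (intro nn_integral_mono mult_right_mono ennreal_leI divide_right_mono)
      (auto simp: field_simps)
  \<comment> \<open>The reflection of \<open>x\<close> to \<open>- x\<close> gives a half-line
    unbounded above, as \<open>nn_integral_FTC_atLeast\<close> expects.\<close>
  also have "\<dots> = (\<integral>\<^sup>+x. ennreal (exp (- x / b) / (2 * b)) * indicator {-a..} x \<partial>lborel)"
    by (subst nn_integral_real_affine[of _ "-1" 0])
       (auto simp: indicator_def intro!: nn_integral_cong)
  also have "\<dots> = ennreal (0 - (- exp (- (- a) / b) / 2))"
  proof (rule nn_integral_FTC_atLeast)
    show "((\<lambda>x. - exp (- x / b) / 2) \<longlongrightarrow> 0) at_top"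
      using b by real_asymp
  qed (use b in \<open>auto intro!: derivative_eq_intros simp: field_simps\<close>)
  finally show ?thesis
    by (simp add: emeasure_eq_measure)
qed

text \<open>A finite alphabet has finitely many strings of length \<open>n\<close>, so
  \<open>Max\<close> ranges over a finite set and is a genuine upper bound.\<close>

lemma global_sensitivity_ge:
  fixes C :: "'a::finite list \<Rightarrow> 'b list"
  assumes "length w = n" "neighbors w w'"
  shows "\<bar>real (length (C w)) - real (length (C w'))\<bar> \<le> global_sensitivity C n"
proof -
  let ?f = "\<lambda>(w, w'). \<bar>real (length (C w)) - real (length (C w'))\<bar>"
  let ?D = "{\<bar>real (length (C w)) - real (length (C w'))\<bar> | w w'.
               length w = n \<and> length w' = n \<and> neighbors w w'}"
  have "finite {w::'a list. length w = n}"
    using finite_lists_length_eq[of "UNIV::'a set" n] by simp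
  then have "finite (?f ` ({w. length w = n} \<times> {w. length w = n}))"
    by simp
  then have "finite ?D"
    by (rule rev_finite_subset) auto
  moreover have "length w' = n" using assms by (simp add: neighbors_def)
  ultimately show ?thesis
    unfolding global_sensitivity_def using assms by (intro Max_ge) auto
qed

text \<open>Pulls events about the output length back to the noise, which reduces privacy to a
  statement about the Laplace measure.\<close>

lemma measure_length_DPCompress:
  "\<P>(y in DPCompress C w \<epsilon> \<delta>. length y \<in> S) =
    measure (laplace (global_sensitivity C (length w) / \<epsilon>))
      {z. length (C w) + pad_length C (length w) \<epsilon> \<delta> z \<in> S}"
proof -
  have "(\<lambda>z. C w @ [0] @ replicate (pad_length C (length w) \<epsilon> \<delta> z - 1) 1)
          \<in> measurable (laplace (global_sensitivity C (length w) / \<epsilon>)) (count_space UNIV)"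
    unfolding pad_length_def by measurable
  \<comment> \<open>The padding length is at least 1, so the subtraction on \<open>nat\<close> does
    not truncate.\<close>
  moreover have "Suc (length (C w) + (pad_length C (length w) \<epsilon> \<delta> z - Suc 0)) =
      length (C w) + pad_length C (length w) \<epsilon> \<delta> z" for z
    by (simp add: pad_length_def)
  ultimately show ?thesis
    by (simp add: DPCompress_def measure_distr vimage_def)
qed

lemma int_pad_length:
  "int (pad_length C n \<epsilon> \<delta> z) = max 1 \<lceil>z + pad_shift C n \<epsilon> \<delta>\<rceil>"
  by (simp add: pad_length_def)

theorem theorem2:
  fixes Compress :: "'a::finite list \<Rightarrow> 'b::{finite, zero_neq_one} list"
    and \<epsilon> \<delta> :: real
  assumes "\<epsilon> > 0" and "\<delta> > 0"
  shows "dp_compression_scheme \<epsilon> \<delta> (\<lambda>w. DPCompress Compress w \<epsilon> \<delta>)"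
  unfolding dp_compression_scheme_def
proof (intro allI impI)
  fix n :: nat and w w' :: "'a list" and S :: "nat set"
  assume "n \<ge> 1" and ww': "length w = n \<and> length w' = n \<and> neighbors w w'"
  define G where "G = global_sensitivity Compress n"
  define b where "b = G / \<epsilon>"
  define k where "k = pad_shift Compress n \<epsilon> \<delta>"
  define p where "p = pad_length Compress n \<epsilon> \<delta>"
  define l l' where "l = length (Compress w)" and "l' = length (Compress w')"
  have p: "int (p z) = max 1 \<lceil>z + k\<rceil>" for z
    by (simp add: p_def k_def int_pad_length)
  have [measurable]: "p \<in> borel \<rightarrow>\<^sub>M count_space UNIV"
    unfolding p_def pad_length_def by measurable
  have G: "\<bar>real l - real l'\<bar> \<le> G"
    unfolding G_def l_def l'_def using ww' by (intro global_sensitivity_ge) auto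
  have "b \<ge> 0" using G assms by (simp add: b_def)
  then interpret prob_space "laplace b" by (rule prob_space_laplace)
  have "measure (laplace b) {z. l + p z \<in> S} \<le>
      exp \<epsilon> * measure (laplace b) {z. l' + p z \<in> S} + \<delta>"
  proof (cases "b = 0")
    case True
    \<comment> \<open>Scale 0 means sensitivity 0, so both inputs yield the same event.\<close>
    then have "l = l'" using G assms by (simp add: b_def)
    moreover have "1 * q \<le> exp \<epsilon> * q" if "q \<ge> 0" for q :: real
      using assms that by (intro mult_right_mono) auto
    ultimately show ?thesis using assms by (simp add: add_increasing2)
  next
    case False
    with \<open>b \<ge> 0\<close> have b: "b > 0" by simp
    define m where "m = int (max l l')"
    \<comment> \<open>The noise values for which the untruncated length on \<open>w'\<close> lies in
      \<open>S\<close> and exceeds \<open>m\<close>.\<close>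
    define A where "A = {z. \<lceil>z + k\<rceil> + int l' \<in> int ` S \<and> \<lceil>z + k\<rceil> + int l' > m}"
    define c where "c = real l - real l'"
    have "(\<lambda>z. \<lceil>z + k\<rceil>) \<in> borel \<rightarrow>\<^sub>M count_space UNIV" by measurable
    from measurable_sets[OF this, of "{i. i + int l' \<in> int ` S \<and> i + int l' > m}"]
    have A [measurable]: "A \<in> sets borel" by (simp add: A_def vimage_def)
    have mG: "real_of_int m - real l \<le> G" using G by (auto simp: m_def)
    \<comment> \<open>As \<open>c\<close> is an integer, it moves out of the ceiling. Hence
      \<open>z + c \<in> A\<close> says of \<open>w\<close> at noise \<open>z\<close> what
      \<open>z \<in> A\<close> says of \<open>w'\<close>.\<close>
    have ceil_shift: "\<lceil>z + c + k\<rceil> = \<lceil>z + k\<rceil> + int l - int l'" for z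
    proof -
      have "z + c + k = z + k + of_int (int l - int l')" by (simp add: c_def)
      then show ?thesis by (simp only: ceiling_add_of_int)
    qed
    have "{z. l + p z \<in> S} \<subseteq> {z. z + c \<in> A} \<union> {..G - k}"
    proof
      fix z assume z: "z \<in> {z. l + p z \<in> S}"
      show "z \<in> {z. z + c \<in> A} \<union> {..G - k}"
      proof (cases "\<lceil>z + k\<rceil> + int l > m")
        case True
        \<comment> \<open>Exceeding \<open>m \<ge> l\<close> forces a positive ceiling, so the
          maximum with 1 in \<open>p\<close> is inactive.\<close>
        then have "\<lceil>z + k\<rceil> \<ge> 1" unfolding m_def by linarith
        then have "\<lceil>z + k\<rceil> + int l = int (l + p z)" by (simp add: p)
        moreover have "int (l + p z) \<in> int ` S" using z by blast
        ultimately have "\<lceil>z + k\<rceil> + int l \<in> int ` S" by metis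
        then show ?thesis using True by (simp add: A_def ceil_shift)
      next
        case False
        then have "z + k \<le> real_of_int (m - int l)" by linarith
        then show ?thesis using mG by auto
      qed
    qed
    then have "measure (laplace b) {z. l + p z \<in> S}
        \<le> measure (laplace b) ({z. z + c \<in> A} \<union> {..G - k})"
      by (intro finite_measure_mono) simp_all
    also have "\<dots> \<le> measure (laplace b) {z. z + c \<in> A} + measure (laplace b) {..G - k}"
      by (intro measure_Un_le) simp_all
    also have "measure (laplace b) {z. z + c \<in> A}
        \<le> exp \<epsilon> * measure (laplace b) {z. l' + p z \<in> S}"
    proof -
      \<comment> \<open>Here the scale \<open>b = G / \<epsilon>\<close> meets
        \<open>\<bar>c\<bar> \<le> G\<close>.\<close>
      have "\<bar>c\<bar> / b \<le> \<epsilon>"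
        using G assms b by (simp add: c_def b_def field_simps)
      moreover have "A \<subseteq> {z. l' + p z \<in> S}"
      proof
        fix z assume z: "z \<in> A"
        then have "\<lceil>z + k\<rceil> + int l' > m" by (simp add: A_def)
        then have "\<lceil>z + k\<rceil> \<ge> 1" unfolding m_def by linarith
        then have "\<lceil>z + k\<rceil> + int l' = int (l' + p z)" by (simp add: p)
        moreover have "\<lceil>z + k\<rceil> + int l' \<in> int ` S" using z by (simp add: A_def)
        ultimately have "int (l' + p z) \<in> int ` S" by metis
        then show "z \<in> {z. l' + p z \<in> S}" by (simp only: image_iff of_nat_eq_iff mem_Collect_eq) simp
      qed
      then have "measure (laplace b) A \<le> measure (laplace b) {z. l' + p z \<in> S}"
        by (intro finite_measure_mono) simp_all
      ultimately have "exp (\<bar>c\<bar> / b) * measure (laplace b) A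
          \<le> exp \<epsilon> * measure (laplace b) {z. l' + p z \<in> S}"
        by (intro mult_mono) auto
      with laplace_shift[OF b A, of c] show ?thesis by linarith
    qed
    also have "measure (laplace b) {..G - k} \<le> \<delta>"
    proof -
      \<comment> \<open>The summand \<open>G\<close> of \<open>k\<close> cancels, and the logarithm
        is such that the tail bound \<open>exp (ln (2 * \<delta>)) / 2\<close> equals
        \<open>\<delta>\<close>.\<close>
      have "G - k = b * ln (2 * \<delta>) - 1"
        using assms by (simp add: k_def pad_shift_def b_def G_def ln_div)
      then have "(G - k) / b \<le> ln (2 * \<delta>)"
        using b by (simp add: field_simps)
      then have "exp ((G - k) / b) \<le> exp (ln (2 * \<delta>))"
        by (simp only: exp_le_cancel_iff)
      with assms laplace_lower_tail[OF b, of "G - k"] show ?thesis by simp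
    qed
    finally show ?thesis by simp
  qed
  then show "\<P>(y in DPCompress Compress w \<epsilon> \<delta>. length y \<in> S)
      \<le> exp \<epsilon> * \<P>(y in DPCompress Compress w' \<epsilon> \<delta>. length y \<in> S) + \<delta>"
    using ww' by (simp add: measure_length_DPCompress l_def l'_def p_def b_def G_def)
qed

end
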